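(* Assume (SH). Let $x\in\operatorname{dom}f$ and let $0<\rho_t\le1$, $t\in T$, satisfy $\inf_{t\in T}\rho_tf_t(x)>-\infty$. Then \[ \partial f(x)=\bigcap_{\varepsilon>0}\overline{\operatorname{co}}\Big(\Big(\bigcup_{t\in T(x)}\partial_\varepsilon f_t(x)\Big)+\Big(\bigcup_{t\in T\setminus T(x)}\{0,\varepsilon\}\,\partial_\varepsilon(\rho_tf_t)(x)\Big)\Big), \] with the convention that the second union equals $\{\theta\}$ when $T(x)=T$.
   Context: $X$ is a real separated locally convex space with dual $X^*$ carrying the weak$^*$ topology; $\theta$ is the zero of $X^*$. $T$ is a nonempty index set, $\{f_t: t\in T\}$ are proper convex lsc functions $X\to\mathbb{R}\cup\{+\infty\}$, $f:=\sup_{t\in T}f_t$. $T(x):=\{t\in T: f_t(x)=f(x)\}$. $\partial_\varepsilon g(x)=\{x^*:\ g(y)\ge g(x)+\langle x^*,y-x\rangle-\varepsilon\ \forall y\}$ if $g(x)\in\mathbb{R}$, $\varepsilon\ge0$ (empty otherwise), $\partial=\partial_0$. For $\Lambda\subset\mathbb{R}$ and a set $A$, $\Lambda A=\{\lambda a:\lambda\in\Lambda,a\in A\}$; $+$ is the Minkowski sum. $\overline{\operatorname{co}}$ is the weak$^*$-closed convex hull. (SH): $T$ is compact Hausdorff and $t\mapsto f_t(z)$ is upper semicontinuous on $T$ for each $z\in X$. *)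

theory Defs
  imports "HOL-Analysis.Analysis"
begin

text \<open>X is modelled by a type 'a carrying a real vector space structure and a
Hausdorff topology (class t2_space); the following predicate says that this
topology is a locally convex vector topology.\<close>

definition lc_tvs :: "'a::{real_vector,t2_space} itself \<Rightarrow> bool" where
  "lc_tvs _ \<longleftrightarrow>
     continuous_on (UNIV :: ('a \<times> 'a) set) (\<lambda>p. fst p + snd p) \<and>
     continuous_on (UNIV :: (real \<times> 'a) set) (\<lambda>p. fst p *\<^sub>R snd p) \<and>
     (\<forall>U (x::'a). open U \<and> x \<in> U \<longrightarrow> (\<exists>V. open V \<and> convex V \<and> x \<in> V \<and> V \<subseteq> U))"

definition dual :: "('a::{real_vector,topological_space} \<Rightarrow> real) set" where
  "dual = {\<phi>. linear \<phi> \<and> continuous_on UNIV \<phi>}"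

text \<open>Weak* topology on X*: subspace topology of the topology of pointwise
convergence (product topology on 'a \<Rightarrow> real, Function_Topology).\<close>
definition weak_star :: "('a::{real_vector,topological_space} \<Rightarrow> real) topology" where
  "weak_star = subtopology euclidean dual"

definition fconvex :: "('a \<Rightarrow> real) set \<Rightarrow> bool" where
  "fconvex C \<longleftrightarrow> (\<forall>a\<in>C. \<forall>b\<in>C. \<forall>u::real. 0 \<le> u \<and> u \<le> 1 \<longrightarrow>
                    (\<lambda>z. u * a z + (1 - u) * b z) \<in> C)"

definition wcco :: "('a::{real_vector,topological_space} \<Rightarrow> real) set \<Rightarrow> ('a \<Rightarrow> real) set" where
  "wcco A = \<Inter>{C. A \<subseteq> C \<and> fconvex C \<and> closedin weak_star C}"

definition msum :: "('a \<Rightarrow> real) set \<Rightarrow> ('a \<Rightarrow> real) set \<Rightarrow> ('a \<Rightarrow> real) set" where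
  "msum A B = {(\<lambda>z. a z + b z) | a b. a \<in> A \<and> b \<in> B}"

definition smul :: "real set \<Rightarrow> ('a \<Rightarrow> real) set \<Rightarrow> ('a \<Rightarrow> real) set" where
  "smul L A = {(\<lambda>z. l * a z) | l a. l \<in> L \<and> a \<in> A}"

text \<open>Extended-real valued functions X \<rightarrow> \<real> \<union> {+\<infinity>} as ereal-valued functions
never taking -\<infinity>.\<close>
definition proper_fn :: "('a \<Rightarrow> ereal) \<Rightarrow> bool" where
  "proper_fn g \<longleftrightarrow> (\<forall>y. g y \<noteq> -\<infinity>) \<and> (\<exists>y. g y \<noteq> \<infinity>)"

definition convex_fn :: "('a::real_vector \<Rightarrow> ereal) \<Rightarrow> bool" where
  "convex_fn g \<longleftrightarrow> (\<forall>x y. \<forall>u::real. 0 < u \<and> u < 1 \<longrightarrow>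
      g (u *\<^sub>R x + (1 - u) *\<^sub>R y) \<le> ereal u * g x + ereal (1 - u) * g y)"

definition lsc_fn :: "('a::topological_space \<Rightarrow> ereal) \<Rightarrow> bool" where
  "lsc_fn g \<longleftrightarrow> (\<forall>c. closed {y. g y \<le> c})"

definition eps_subdiff :: "real \<Rightarrow> ('a::{real_vector,topological_space} \<Rightarrow> ereal) \<Rightarrow> 'a \<Rightarrow> ('a \<Rightarrow> real) set" where
  "eps_subdiff \<epsilon> g x =
     (if g x \<in> range ereal then
        {\<phi> \<in> dual. \<forall>y. g y \<ge> ereal (real_of_ereal (g x) + \<phi> (y - x) - \<epsilon>)}
      else {})"

end

theory Submission
  imports Defs "HOL-Library.Function_Algebras"
begin

text \<open>If \<open>\<phi> \<in> \<partial>f(x)\<close> is not in the weak* closed convex hull for some \<open>\<epsilon>\<close>, a direction \<open>u\<close>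
  separates it strictly from the sum set. The support function of \<open>\<partial>\<^sub>\<epsilon>g(x)\<close> at \<open>u\<close> is the infimum of
  \<open>(g(x + s u) - g(x) + \<epsilon>) / s\<close> over \<open>s > 0\<close>, so for each active \<open>t\<close> some \<open>s > 0\<close> satisfies
  \<open>f\<^sub>t(x + s u) < f(x) - \<epsilon> + s \<alpha>'\<close> with \<open>\<alpha>' < \<phi>(u)\<close>, whereas for each inactive \<open>t\<close> the function
  \<open>f\<^sub>t\<close> is finite somewhere on the ray. By upper semicontinuity in \<open>t\<close> both facts persist near \<open>t\<close>,
  by convexity they persist for smaller \<open>s\<close>, and compactness of \<open>T\<close> yields a single \<open>s > 0\<close> with
  \<open>f(x + s u) \<le> f(x) + s \<alpha>'\<close>, contradicting \<open>\<phi> \<in> \<partial>f(x)\<close>. Conversely, every element of the sum set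
  satisfies the subgradient inequality of \<open>f\<close> at \<open>y\<close> up to an error that vanishes with \<open>\<epsilon>\<close>,
  because \<open>\<rho>\<^sub>s f\<^sub>s(y) - \<rho>\<^sub>s f\<^sub>s(x)\<close> is bounded above uniformly in \<open>s\<close>; this inequality survives
  weak* closed convex hulls.\<close>

section \<open>Hahn--Banach theorem and weak* separation\<close>

text \<open>This is the one-step extension behind Hahn--Banach: the inequality
  \<open>f w \<le> b\<close> joins a consistent system. A vertical element \<open>(0, t)\<close>
  that uses the new ray with a factor \<open>s > 0\<close> becomes, after division by
  \<open>s\<close>, an old element \<open>(- w, r / s)\<close>, which \<open>ray\<close>
  controls.\<close>

lemma convex_cone_add_ray:
  fixes M :: "('v::real_vector \<times> real) set"
  assumes M: "convex_cone M"
    and nonneg: "\<And>t. (0, t) \<in> M \<Longrightarrow> 0 \<le> t"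
    and ray: "\<And>t. (- w, t) \<in> M \<Longrightarrow> - b \<le> t"
  obtains M' where "convex_cone M'" "M \<subseteq> M'" "(w, b) \<in> M'" "\<And>t. (0, t) \<in> M' \<Longrightarrow> 0 \<le> t"
proof
  define M' where "M' = {m + s *\<^sub>R (w, b) | m s. m \<in> M \<and> 0 \<le> s}"
  have intro: "m + s *\<^sub>R (w, b) \<in> M'" if "m \<in> M" "0 \<le> s" for m s
    using that unfolding M'_def by blast
  have 0: "0 \<in> M"
    using M by (rule convex_cone_contains_0)
  show "M \<subseteq> M'"
    using intro[of _ 0] by auto
  show "(w, b) \<in> M'"
    using intro[OF 0, of 1] by simp
  show "convex_cone M'"
    unfolding convex_cone_iff
  proof (intro conjI ballI allI impI)
    show "0 \<in> M'"
      using intro[OF 0, of 0] by (simp add: zero_prod_def)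
  next
    fix p q assume "p \<in> M'" "q \<in> M'"
    then obtain m s n r where "p = m + s *\<^sub>R (w, b)" "q = n + r *\<^sub>R (w, b)"
      "m \<in> M" "n \<in> M" "0 \<le> s" "0 \<le> r"
      unfolding M'_def by blast
    then show "p + q \<in> M'"
      using intro[of "m + n" "s + r"] convex_cone_add[OF M, of m n] by (simp add: algebra_simps)
  next
    fix p and c :: real assume "p \<in> M'" "0 \<le> c"
    then obtain m s where "p = m + s *\<^sub>R (w, b)" "m \<in> M" "0 \<le> s"
      unfolding M'_def by blast
    then show "c *\<^sub>R p \<in> M'"
      using intro[of "c *\<^sub>R m" "c * s"] convex_cone_scaleR[OF M \<open>0 \<le> c\<close>, of m] \<open>0 \<le> c\<close>
      by (simp add: scaleR_add_right mult.assoc)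
  qed
  fix t assume "(0, t) \<in> M'"
  then obtain v r s where m: "(v, r) \<in> M" and s: "0 \<le> s" and eq: "v + s *\<^sub>R w = 0" "t = r + s * b"
    unfolding M'_def by auto
  show "0 \<le> t"
  proof (cases "s = 0")
    case True
    then show ?thesis using m eq nonneg by auto
  next
    case False
    with s have "s > 0" by simp
    have "v = - (s *\<^sub>R w)"
      using eq(1) by (simp add: eq_neg_iff_add_eq_0)
    then have "(1 / s) *\<^sub>R (v, r) = (- w, r / s)"
      using \<open>s > 0\<close> by simp
    then have "(- w, r / s) \<in> M"
      using convex_cone_scaleR[OF M _ m, of "1 / s"] s by simp
    then have "- b \<le> r / s" by (rule ray)
    with \<open>s > 0\<close> eq(2) show ?thesis by (simp add: field_simps)
  qed
qed

text \<open>A cone \<open>P\<close> of pairs \<open>(v, t)\<close> stands for the system of inequalities \<open>f v \<le> t\<close>.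
  This form of the Hahn--Banach theorem says that the system is solvable by a linear \<open>f\<close>
  unless it contains the inequality \<open>f 0 \<le> t\<close> for some \<open>t < 0\<close>.\<close>

lemma convex_cone_linear_minorant:
  fixes P :: "('v::real_vector \<times> real) set"
  assumes P: "convex_cone P"
    and nonneg: "\<And>t. (0, t) \<in> P \<Longrightarrow> 0 \<le> t"
    and full: "\<And>v. \<exists>t. (v, t) \<in> P"
  obtains f where "linear f" "\<And>v t. (v, t) \<in> P \<Longrightarrow> f v \<le> t"
proof -
  define \<A> where "\<A> = {M. convex_cone M \<and> P \<subseteq> M \<and> (\<forall>t. (0, t) \<in> M \<longrightarrow> 0 \<le> t)}"
  \<comment> \<open>Zorn's lemma gives a maximal consistent system; each defining condition involves
    at most two elements, so it passes to unions of chains.\<close>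
  have "\<exists>M\<in>\<A>. \<forall>X\<in>\<A>. M \<subseteq> X \<longrightarrow> X = M"
  proof (rule subset_Zorn_nonempty)
    show "\<A> \<noteq> {}"
      using P nonneg unfolding \<A>_def by blast
  next
    fix \<C> assume ne: "\<C> \<noteq> {}" and ch: "subset.chain \<A> \<C>"
    then have sub: "\<C> \<subseteq> \<A>" and tot: "\<And>A B. A \<in> \<C> \<Longrightarrow> B \<in> \<C> \<Longrightarrow> A \<subseteq> B \<or> B \<subseteq> A"
      by (auto simp: subset_chain_def)
    have cone: "convex_cone M" if "M \<in> \<C>" for M
      using sub that unfolding \<A>_def by blast
    have "convex_cone (\<Union>\<C>)"
      unfolding convex_cone_iff
    proof (intro conjI ballI allI impI)
      show "0 \<in> \<Union>\<C>"
        using ne cone convex_cone_contains_0 by blast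
    next
      fix p q assume "p \<in> \<Union>\<C>" "q \<in> \<Union>\<C>"
      then obtain A B where "A \<in> \<C>" "B \<in> \<C>" "p \<in> A" "q \<in> B" by blast
      then obtain C where "C \<in> \<C>" "p \<in> C" "q \<in> C"
        using tot[of A B] by blast
      then show "p + q \<in> \<Union>\<C>"
        using cone convex_cone_add by blast
    next
      fix p and c :: real assume "p \<in> \<Union>\<C>" "0 \<le> c"
      then show "c *\<^sub>R p \<in> \<Union>\<C>"
        using cone convex_cone_scaleR by blast
    qed
    then show "\<Union>\<C> \<in> \<A>"
      using ne sub unfolding \<A>_def by blast
  qed
  then obtain M where "M \<in> \<A>" and max: "\<And>X. X \<in> \<A> \<Longrightarrow> M \<subseteq> X \<Longrightarrow> X = M"
    by blast
  then have M: "convex_cone M" and PM: "P \<subseteq> M" and M0: "\<And>t. (0, t) \<in> M \<Longrightarrow> 0 \<le> t"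
    unfolding \<A>_def by auto
  \<comment> \<open>Maximality: an inequality \<open>f w \<le> b\<close> that nothing in
    \<open>M\<close> contradicts already belongs to \<open>M\<close>.\<close>
  have ray: "(w, b) \<in> M" if wb: "\<And>t. (- w, t) \<in> M \<Longrightarrow> - b \<le> t" for w b
  proof -
    obtain M' where "convex_cone M'" "M \<subseteq> M'" "(w, b) \<in> M'" "\<And>t. (0, t) \<in> M' \<Longrightarrow> 0 \<le> t"
      using convex_cone_add_ray[OF M M0 wb] by blast
    then show ?thesis
      using max[of M'] PM unfolding \<A>_def by blast
  qed
  \<comment> \<open>The best upper bound \<open>Inf L\<close> that \<open>M\<close> imposes at
    \<open>v\<close> is also consistent as a lower bound, so \<open>M\<close> contains both and
    thereby fixes the value at \<open>v\<close>.\<close>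
  have "\<exists>a. (v, a) \<in> M \<and> (- v, - a) \<in> M" for v
  proof -
    define L where "L = {t. (v, t) \<in> M}"
    have le: "- s \<le> t" if "(- v, s) \<in> M" "t \<in> L" for s t
      using M0[of "s + t"] convex_cone_add[OF M that(1), of "(v, t)"] that(2)
      by (simp add: L_def)
    obtain s where s: "(- v, s) \<in> M" using full PM by blast
    have ne: "L \<noteq> {}" using full PM unfolding L_def by blast
    have bdd: "bdd_below L" using le[OF s] by (rule bdd_belowI)
    have "(v, Inf L) \<in> M"
      using cInf_greatest[OF ne] le by (intro ray) (smt (verit))
    moreover have "(- v, - Inf L) \<in> M"
      using cInf_lower[OF _ bdd] by (intro ray) (simp add: L_def)
    ultimately show ?thesis by blast
  qed
  then obtain f where f: "\<And>v. (v, f v) \<in> M" "\<And>v. (- v, - f v) \<in> M"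
    by metis
  \<comment> \<open>Since \<open>M\<close> contains \<open>(v, f v)\<close> and
    \<open>(- v, - f v)\<close>, upper and lower estimates meet, and closure under sums and
    multiples becomes linearity of \<open>f\<close>.\<close>
  have least: "f v \<le> t" if "(v, t) \<in> M" for v t
    using M0[of "- f v + t"] convex_cone_add[OF M f(2)[of v] that] by simp
  have greatest: "t \<le> f v" if "(- v, - t) \<in> M" for v t
    using M0[of "f v - t"] convex_cone_add[OF M f(1)[of v] that] by simp
  have scale: "f (c *\<^sub>R v) = c * f v" if "0 \<le> c" for c v
    using least[of "c *\<^sub>R v" "c * f v"] greatest[of "c *\<^sub>R v" "c * f v"]
      convex_cone_scaleR[OF M that f(1)[of v]] convex_cone_scaleR[OF M that f(2)[of v]]
    by simp
  have neg: "f (- v) = - f v" for v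
    using least[OF f(2)[of v]] greatest[of "- v" "- f v"] f(1)[of v] by simp
  have "linear f"
  proof (rule linearI)
    fix v w
    show "f (v + w) = f v + f w"
      using least[of "v + w" "f v + f w"] greatest[of "v + w" "f v + f w"]
        convex_cone_add[OF M f(1)[of v] f(1)[of w]] convex_cone_add[OF M f(2)[of v] f(2)[of w]]
      by simp
  next
    fix c v
    show "f (c *\<^sub>R v) = c *\<^sub>R f v"
      using scale[of c v] scale[of "- c" v] neg[of "c *\<^sub>R v"] by (cases "0 \<le> c") auto
  qed
  then show thesis
    using that least PM by blast
qed

text \<open>The lower bound at \<open>u\<close> is the inequality
  \<open>f (- u) \<le> - \<alpha>\<close>, which is adjoined as a ray before the extension.\<close>

corollary convex_cone_linear_minorant_ge:
  fixes P :: "('v::real_vector \<times> real) set"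
  assumes P: "convex_cone P"
    and nonneg: "\<And>t. (0, t) \<in> P \<Longrightarrow> 0 \<le> t"
    and full: "\<And>v. \<exists>t. (v, t) \<in> P"
    and u: "\<And>t. (u, t) \<in> P \<Longrightarrow> \<alpha> \<le> t"
  obtains f where "linear f" "\<And>v t. (v, t) \<in> P \<Longrightarrow> f v \<le> t" "\<alpha> \<le> f u"
proof -
  obtain M where M: "convex_cone M" "P \<subseteq> M" "(- u, - \<alpha>) \<in> M" "\<And>t. (0, t) \<in> M \<Longrightarrow> 0 \<le> t"
    using convex_cone_add_ray[OF P nonneg, of "- u" "- \<alpha>"] u by auto
  then obtain f where f: "linear f" "\<And>v t. (v, t) \<in> M \<Longrightarrow> f v \<le> t"
    using convex_cone_linear_minorant[of M] full by blast
  then have "\<alpha> \<le> f u"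
    using M(3) by (fastforce simp: linear_neg)
  with f M(2) that show thesis by blast
qed

section \<open>Functions as a real vector space, and weak* separation\<close>

instantiation "fun" :: (type, real_vector) real_vector
begin

definition scaleR_fun :: "real \<Rightarrow> ('a \<Rightarrow> 'b) \<Rightarrow> 'a \<Rightarrow> 'b"
  where "scaleR_fun r f = (\<lambda>x. r *\<^sub>R f x)"

instance
  by standard (auto simp: scaleR_fun_def fun_eq_iff scaleR_add_right scaleR_add_left)

end

lemma scaleR_fun_apply [simp]: "(r *\<^sub>R f) x = r *\<^sub>R f x"
  by (simp add: scaleR_fun_def)

lemma sum_fun_apply: "(\<Sum>i\<in>I. f i) x = (\<Sum>i\<in>I. f i x)"
  by (induction I rule: infinite_finite_induct) auto

text \<open>A basic open set of the product topology constrains finitely many coordinates, so the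
  least of their radii serves; the inserted 1 covers the case of no constrained coordinate.\<close>

lemma open_fun_contains_box:
  fixes f :: "'i \<Rightarrow> real"
  assumes "open U" "f \<in> U"
  obtains I \<delta> where "finite I" "0 < \<delta>" "\<And>g. (\<And>i. i \<in> I \<Longrightarrow> \<bar>g i - f i\<bar> < \<delta>) \<Longrightarrow> g \<in> U"
proof -
  obtain X where X: "f \<in> (\<Pi>\<^sub>E i\<in>UNIV. X i)" "\<And>i. open (X i)" "finite {i. X i \<noteq> UNIV}"
      "(\<Pi>\<^sub>E i\<in>UNIV. X i) \<subseteq> U"
    using product_topology_open_contains_basis[of "\<lambda>i. euclidean" UNIV U f] assms
    by (auto simp: open_fun_def)
  define I where "I = {i. X i \<noteq> UNIV}"
  have "\<forall>i. \<exists>d>0. \<forall>r. \<bar>r - f i\<bar> < d \<longrightarrow> r \<in> X i"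
  proof
    fix i
    have "f i \<in> X i" using X(1) by auto
    with X(2)[of i] show "\<exists>d>0. \<forall>r. \<bar>r - f i\<bar> < d \<longrightarrow> r \<in> X i"
      unfolding open_dist dist_real_def by blast
  qed
  then obtain d where d: "\<And>i. 0 < d i" "\<And>i r. \<bar>r - f i\<bar> < d i \<Longrightarrow> r \<in> X i"
    by metis
  define \<delta> where "\<delta> = Min (insert 1 (d ` I))"
  have fin: "finite I" using X(3) by (simp add: I_def)
  then have "0 < \<delta>" and le: "\<And>i. i \<in> I \<Longrightarrow> \<delta> \<le> d i"
    using d(1) by (auto simp: \<delta>_def)
  moreover have "g \<in> U" if g: "\<And>i. i \<in> I \<Longrightarrow> \<bar>g i - f i\<bar> < \<delta>" for g
  proof -
    have "g i \<in> X i" for i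
      using d(2)[of "g i" i] g[of i] le[of i] by (cases "i \<in> I") (auto simp: I_def)
    with X(4) show ?thesis by auto
  qed
  ultimately show thesis using that fin by blast
qed

text \<open>Hahn--Banach is applied in the space of all functions
  \<open>'a \<Rightarrow> real\<close>. A basic neighbourhood of \<open>\<phi>\<close> involves only
  finitely many coordinates, so the functional obtained depends on these alone and acts on the dual
  as evaluation at one point \<open>u\<close>.\<close>

lemma weak_star_separation:
  fixes C :: "('a::{real_vector,topological_space} \<Rightarrow> real) set"
  assumes clo: "closedin weak_star C" and cvx: "fconvex C"
    and \<phi>: "\<phi> \<in> dual" "\<phi> \<notin> C"
  obtains u \<alpha> where "\<alpha> < \<phi> u" "\<And>c. c \<in> C \<Longrightarrow> c u \<le> \<alpha>"
proof -
  have Cd: "C \<subseteq> dual"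
    using closedin_subset[OF clo] by (simp add: weak_star_def)
  obtain S where S: "closed S" "C = S \<inter> dual"
    using clo by (auto simp: weak_star_def closedin_subtopology)
  then obtain I \<delta> where I: "finite I" and \<delta>: "0 < \<delta>"
    and box: "\<And>g. (\<And>i. i \<in> I \<Longrightarrow> \<bar>g i - \<phi> i\<bar> < \<delta>) \<Longrightarrow> g \<in> - S"
    using open_fun_contains_box[of "- S" \<phi>] \<phi> by (metis Compl_iff Int_iff open_Compl)
  \<comment> \<open>The cone encodes two demands: \<open>f (c - \<phi>) \<le> - 1\<close> for
    \<open>c\<close> in \<open>C\<close>, and \<open>f w \<le> r\<close> whenever
    \<open>\<bar>w\<bar> \<le> \<delta> * r\<close> on \<open>I\<close>.\<close>
  define P where "P = {(\<lambda>i. \<tau> * (c i - \<phi> i) + w i, r - \<tau>) | \<tau> c w r.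
    0 \<le> \<tau> \<and> (\<tau> > 0 \<longrightarrow> c \<in> C) \<and> (\<forall>i\<in>I. \<bar>w i\<bar> \<le> \<delta> * r) \<and> 0 \<le> r}"
  have PI: "(v, t) \<in> P" if "0 \<le> \<tau>" "\<tau> > 0 \<Longrightarrow> c \<in> C" "\<And>i. i \<in> I \<Longrightarrow> \<bar>w i\<bar> \<le> \<delta> * r" "0 \<le> r"
    "\<And>i. v i = \<tau> * (c i - \<phi> i) + w i" "t = r - \<tau>" for v t \<tau> c w r
    unfolding P_def using that by blast
  have w: "(w, r) \<in> P" if "\<And>i. i \<in> I \<Longrightarrow> \<bar>w i\<bar> \<le> \<delta> * r" "0 \<le> r" for w r
    using that by (intro PI[of 0 \<phi> w r]) auto
  have "convex_cone P"
    unfolding convex_cone_iff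
  proof (intro conjI ballI allI impI)
    show "0 \<in> P"
      using w[of 0 0] by (simp add: zero_prod_def)
  next
    fix p q assume "p \<in> P" "q \<in> P"
    then obtain \<tau> c w r \<tau>' c' w' r' where
      p: "p = (\<lambda>i. \<tau> * (c i - \<phi> i) + w i, r - \<tau>)" "0 \<le> \<tau>" "\<tau> > 0 \<longrightarrow> c \<in> C"
        "\<forall>i\<in>I. \<bar>w i\<bar> \<le> \<delta> * r" "0 \<le> r" and
      q: "q = (\<lambda>i. \<tau>' * (c' i - \<phi> i) + w' i, r' - \<tau>')" "0 \<le> \<tau>'" "\<tau>' > 0 \<longrightarrow> c' \<in> C"
        "\<forall>i\<in>I. \<bar>w' i\<bar> \<le> \<delta> * r'" "0 \<le> r'"
      unfolding P_def by (auto; blast)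
    \<comment> \<open>Relative weight of \<open>c\<close>; if both weights vanish, division by zero
      yields 0 and the identities below still hold.\<close>
    define u where "u = \<tau> / (\<tau> + \<tau>')"
    define c'' where "c'' = (\<lambda>i. u * c i + (1 - u) * c' i)"
    have u1: "(\<tau> + \<tau>') * u = \<tau>"
      using p(2) q(2) by (cases "\<tau> + \<tau>' = 0") (auto simp: u_def)
    then have uu: "(\<tau> + \<tau>') * u = \<tau>" "(\<tau> + \<tau>') * (1 - u) = \<tau>'"
      by (auto simp: right_diff_distrib)
    have "c'' \<in> C" if "\<tau> + \<tau>' > 0"
    proof -
      consider "\<tau> = 0" "\<tau>' > 0" | "\<tau> > 0" "\<tau>' = 0" | "\<tau> > 0" "\<tau>' > 0"
        using p(2) q(2) \<open>\<tau> + \<tau>' > 0\<close> by linarith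
      then show ?thesis
      proof cases
        case 3
        then have "0 \<le> u" "u \<le> 1" by (auto simp: u_def)
        then show ?thesis
          using cvx p(3) q(3) 3 unfolding fconvex_def c''_def by blast
      qed (use p(3) q(3) in \<open>auto simp: c''_def u_def\<close>)
    qed
    moreover have "\<tau> * (c i - \<phi> i) + w i + (\<tau>' * (c' i - \<phi> i) + w' i)
        = (\<tau> + \<tau>') * (c'' i - \<phi> i) + (w i + w' i)" for i
    proof -
      have "(\<tau> + \<tau>') * c'' i = ((\<tau> + \<tau>') * u) * c i + ((\<tau> + \<tau>') * (1 - u)) * c' i"
        by (simp add: c''_def algebra_simps)
      then show ?thesis unfolding uu by (simp add: algebra_simps)
    qed
    moreover have "\<bar>w i + w' i\<bar> \<le> \<delta> * (r + r')" if "i \<in> I" for i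
      using p(4) q(4) that by (smt (verit) distrib_left)
    ultimately show "p + q \<in> P"
      unfolding p(1) q(1) plus_prod_def fst_conv snd_conv
      using p(2,5) q(2,5) by (intro PI[of "\<tau> + \<tau>'" c'' "w + w'" "r + r'"]) auto
  next
    fix p and k :: real assume "p \<in> P" "0 \<le> k"
    then obtain \<tau> c w r where
      p: "p = (\<lambda>i. \<tau> * (c i - \<phi> i) + w i, r - \<tau>)" "0 \<le> \<tau>" "\<tau> > 0 \<longrightarrow> c \<in> C"
        "\<forall>i\<in>I. \<bar>w i\<bar> \<le> \<delta> * r" "0 \<le> r"
      unfolding P_def by auto
    have "\<bar>k * w i\<bar> \<le> \<delta> * (k * r)" if "i \<in> I" for i
      using p(4) that mult_left_mono[of "\<bar>w i\<bar>" "\<delta> * r" k] \<open>0 \<le> k\<close>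
      by (simp add: abs_mult mult.left_commute)
    then show "k *\<^sub>R p \<in> P"
      unfolding p(1) scaleR_prod_def fst_conv snd_conv
      using p(2,3,5) \<open>0 \<le> k\<close>
      by (intro PI[of "k * \<tau>" c "k *\<^sub>R w" "k * r"])
         (auto simp: algebra_simps zero_less_mult_iff)
  qed
  \<comment> \<open>A negative \<open>t\<close> means \<open>r < \<tau>\<close>, which puts
    \<open>c\<close> within \<open>\<delta>\<close> of \<open>\<phi>\<close> on \<open>I\<close>,
    that is, in the box disjoint from \<open>S\<close>.\<close>
  moreover have "0 \<le> t" if t0: "(0, t) \<in> P" for t
  proof -
    obtain \<tau> c w r where
      p: "(\<lambda>i. \<tau> * (c i - \<phi> i) + w i) = 0" "t = r - \<tau>" "0 \<le> \<tau>" "\<tau> > 0 \<longrightarrow> c \<in> C"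
        "\<forall>i\<in>I. \<bar>w i\<bar> \<le> \<delta> * r" "0 \<le> r"
      using t0 unfolding P_def by (auto; blast)
    show ?thesis
    proof (rule ccontr)
      assume "\<not> 0 \<le> t"
      with p have lt: "r < \<tau>" and c: "c \<in> C" by auto
      have "\<bar>c i - \<phi> i\<bar> < \<delta>" if "i \<in> I" for i
      proof -
        have "w i = - (\<tau> * (c i - \<phi> i))"
          using fun_cong[OF p(1), of i] by (simp add: eq_neg_iff_add_eq_0 add.commute)
        then have "\<tau> * \<bar>c i - \<phi> i\<bar> = \<bar>w i\<bar>"
          using p(3) by (simp add: abs_mult)
        also have "\<dots> \<le> \<delta> * r" using p(5) that by blast
        also have "\<dots> < \<tau> * \<delta>" using lt \<delta> by (simp add: mult.commute)
        finally show ?thesis using lt p(6) by simp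
      qed
      then show False using box c S(2) by blast
    qed
  qed
  moreover have "\<exists>t. (v, t) \<in> P" for v
  proof
    define m where "m = Max (insert 0 ((\<lambda>i. \<bar>v i\<bar>) ` I))"
    have "0 \<le> m" "\<And>i. i \<in> I \<Longrightarrow> \<bar>v i\<bar> \<le> m"
      using I by (auto simp: m_def)
    then show "(v, m / \<delta>) \<in> P"
      using \<delta> by (intro w) auto
  qed
  ultimately obtain f where f: "linear f" and fle: "\<And>v t. (v, t) \<in> P \<Longrightarrow> f v \<le> t"
    using convex_cone_linear_minorant[of P] by blast
  \<comment> \<open>Both \<open>v\<close> and \<open>- v\<close> satisfy the box condition with
    \<open>r = 0\<close>.\<close>
  have vanish: "f v = 0" if "\<And>i. i \<in> I \<Longrightarrow> v i = 0" for v
    using fle[OF w[of v 0]] fle[OF w[of "- v" 0]] that linear_neg[OF f, of v] by simp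
  define e :: "'a \<Rightarrow> 'a \<Rightarrow> real" where "e = (\<lambda>i j. if j = i then 1 else 0)"
  \<comment> \<open>The values of \<open>f\<close> on the coordinate functions become the
    coefficients of the representing point; linearity of a dual functional moves them into its
    argument.\<close>
  define u where "u = (\<Sum>i\<in>I. f (e i) *\<^sub>R i)"
  have rep: "f v = (\<Sum>i\<in>I. v i * f (e i))" for v
  proof -
    have "(v - (\<Sum>i\<in>I. v i *\<^sub>R e i)) j = 0" if "j \<in> I" for j
      using I that by (simp add: sum_fun_apply e_def if_distrib[of "(*) _"] cong: if_cong)
    then have "f (v - (\<Sum>i\<in>I. v i *\<^sub>R e i)) = 0"
      by (rule vanish)
    then show ?thesis
      by (simp add: linear_diff[OF f] linear_sum[OF f] linear_cmul[OF f])
  qed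
  have eval: "f \<psi> = \<psi> u" if "\<psi> \<in> dual" for \<psi>
  proof -
    have "linear \<psi>" using that by (simp add: dual_def)
    then show ?thesis
      by (simp add: rep[of \<psi>] u_def linear_sum linear_cmul mult.commute)
  qed
  have "c u \<le> \<phi> u - 1" if "c \<in> C" for c
  proof -
    have "(c - \<phi>, - 1) \<in> P"
      using that by (intro PI[of 1 c 0 0]) auto
    then have "f c - f \<phi> \<le> - 1"
      using fle linear_diff[OF f] by metis
    then show ?thesis
      using eval[of c] eval[of \<phi>] that Cd \<phi>(1) by auto
  qed
  then show thesis by (intro that[of "\<phi> u - 1"]) auto
qed

section \<open>Approximate subdifferentials of convex lsc functions\<close>

lemma lc_tvs_continuous_add:
  fixes f g :: "'b::topological_space \<Rightarrow> 'a::{real_vector,t2_space}"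
  assumes "lc_tvs TYPE('a)" "continuous_on S f" "continuous_on S g"
  shows "continuous_on S (\<lambda>z. f z + g z)"
proof -
  have "continuous_on (UNIV :: ('a \<times> 'a) set) (\<lambda>p. fst p + snd p)"
    using assms(1) by (simp add: lc_tvs_def)
  from continuous_on_compose2[OF this continuous_on_Pair[OF assms(2,3)]] show ?thesis by simp
qed

lemma lc_tvs_continuous_scaleR:
  fixes f :: "'b::topological_space \<Rightarrow> real" and g :: "'b \<Rightarrow> 'a::{real_vector,t2_space}"
  assumes "lc_tvs TYPE('a)" "continuous_on S f" "continuous_on S g"
  shows "continuous_on S (\<lambda>z. f z *\<^sub>R g z)"
proof -
  have "continuous_on (UNIV :: (real \<times> 'a) set) (\<lambda>p. fst p *\<^sub>R snd p)"
    using assms(1) by (simp add: lc_tvs_def)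
  from continuous_on_compose2[OF this continuous_on_Pair[OF assms(2,3)]] show ?thesis by simp
qed

lemma lc_tvs_absorbing:
  fixes W :: "'a::{real_vector,t2_space} set"
  assumes lc: "lc_tvs TYPE('a)" and W: "open W" "0 \<in> W"
  obtains k where "0 < k" "k *\<^sub>R v \<in> W"
proof -
  have "continuous_on UNIV (\<lambda>k::real. k *\<^sub>R v)"
    by (intro lc_tvs_continuous_scaleR lc continuous_intros)
  then have "open ((\<lambda>k::real. k *\<^sub>R v) -` W)"
    using W(1) by (rule open_vimage[rotated])
  moreover have "0 \<in> (\<lambda>k::real. k *\<^sub>R v) -` W"
    using W(2) by simp
  ultimately obtain e where e: "e > 0" "\<And>k. dist k 0 < e \<Longrightarrow> k *\<^sub>R v \<in> W"
    unfolding open_dist vimage_eq by blast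
  then show thesis
    by (intro that[of "e / 2"]) (auto simp: dist_real_def)
qed

text \<open>A one-sided bound suffices because it is applied to \<open>k\<close> times both
  \<open>z - y\<close> and \<open>y - z\<close>. Differences are written with the scalar
  \<open>- 1\<close> since \<open>lc_tvs\<close> speaks of addition and scaling.\<close>

lemma lc_tvs_linear_continuous:
  fixes f :: "'a::{real_vector,t2_space} \<Rightarrow> real"
  assumes lc: "lc_tvs TYPE('a)" and f: "linear f"
    and W: "open W" "0 \<in> W" and bound: "\<And>w. w \<in> W \<Longrightarrow> - e \<le> f w"
  shows "continuous_on UNIV f"
  unfolding continuous_on_def
proof (intro ballI tendstoI)
  fix y :: 'a and \<eta> :: real
  assume "0 < \<eta>"
  have "0 \<le> e" using bound[OF W(2)] linear_0[OF f] by simp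
  define k where "k = (e + 1) / \<eta>"
  have k: "0 < k" "e < k * \<eta>"
    using \<open>0 \<le> e\<close> \<open>0 < \<eta>\<close> by (auto simp: k_def)
  have eval: "f (k *\<^sub>R (p + (- 1) *\<^sub>R q)) = k * (f p - f q)" for p q
    by (simp add: linear_cmul[OF f] linear_diff[OF f])
  define S where "S = (\<lambda>z. k *\<^sub>R (z + (- 1) *\<^sub>R y)) -` W \<inter> (\<lambda>z. k *\<^sub>R (y + (- 1) *\<^sub>R z)) -` W"
  have "open S"
    unfolding S_def
    by (intro open_Int open_vimage[OF W(1)] lc_tvs_continuous_scaleR lc_tvs_continuous_add lc
        continuous_intros)
  moreover have "y \<in> S"
    using W(2) by (simp add: S_def)
  moreover have "dist (f z) (f y) < \<eta>" if "z \<in> S" for z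
  proof -
    have "- e \<le> k * (f z - f y)" "- e \<le> k * (f y - f z)"
      using that bound unfolding S_def eval[symmetric] by auto
    then have "k * (f y - f z) < k * \<eta>" "k * (f z - f y) < k * \<eta>"
      using k(2) by (auto simp: algebra_simps)
    then have "f y - f z < \<eta>" "f z - f y < \<eta>"
      using k(1) mult_less_cancel_left_pos by blast+
    then show ?thesis by (simp add: dist_real_def)
  qed
  ultimately show "eventually (\<lambda>z. dist (f z) (f y) < \<eta>) (at y within UNIV)"
    unfolding eventually_at_topological by blast
qed

section \<open>Convex lsc functions along rays\<close>

lemma lsc_fn_open: "lsc_fn g \<Longrightarrow> open {y. k < g y}"
  unfolding lsc_fn_def by (simp add: closed_def Compl_eq linorder_not_le)

lemma convex_fn_le:
  assumes g: "convex_fn g" and le: "g y \<le> ereal q" "g x \<le> ereal p" and l: "0 \<le> l" "l \<le> 1"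
  shows "g (l *\<^sub>R y + (1 - l) *\<^sub>R x) \<le> ereal (l * q + (1 - l) * p)"
proof -
  consider "l = 0" | "l = 1" | "0 < l" "l < 1" using l by linarith
  then show ?thesis
  proof cases
    case 3
    then have "g (l *\<^sub>R y + (1 - l) *\<^sub>R x) \<le> ereal l * g y + ereal (1 - l) * g x"
      using g unfolding convex_fn_def by blast
    also have "\<dots> \<le> ereal l * ereal q + ereal (1 - l) * ereal p"
      using 3 le by (intro add_mono ereal_mult_left_mono) auto
    finally show ?thesis by simp
  qed (use le in auto)
qed

lemma convex_fn_ray_le:
  assumes g: "convex_fn g" and le: "g x \<le> ereal p" "g (x + s1 *\<^sub>R u) \<le> ereal q"
    and s: "0 \<le> s" "s \<le> s1" "0 < s1"
  shows "g (x + s *\<^sub>R u) \<le> ereal (p + s / s1 * (q - p))"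
proof -
  define l where "l = s / s1"
  have "l *\<^sub>R (x + s1 *\<^sub>R u) + (1 - l) *\<^sub>R x = x + s *\<^sub>R u"
    using s by (simp add: l_def algebra_simps)
  moreover have "g (l *\<^sub>R (x + s1 *\<^sub>R u) + (1 - l) *\<^sub>R x) \<le> ereal (l * q + (1 - l) * p)"
    using s by (intro convex_fn_le g le) (auto simp: l_def)
  moreover have "l * q + (1 - l) * p = p + l * (q - p)"
    by (simp add: algebra_simps)
  ultimately show ?thesis
    by (simp add: l_def)
qed

text \<open>On the compact parameter range \<open>{0..s0}\<close> lower semicontinuity and the tube
  lemma make the bound uniform in a neighbourhood \<open>W\<close>. Any other point is pulled back
  towards \<open>x\<close> into this region, where convexity transfers the estimate.\<close>

lemma convex_lsc_lower_bound_near_ray: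
  fixes g :: "'a::{real_vector,t2_space} \<Rightarrow> ereal"
  assumes lc: "lc_tvs TYPE('a)" and cvx: "convex_fn g" and lsc: "lsc_fn g"
    and gx: "g x = ereal c" and \<epsilon>: "0 < \<epsilon>" and \<alpha>: "\<alpha> < \<alpha>'"
    and ray: "\<And>s. 0 < s \<Longrightarrow> ereal (c - \<epsilon> + s * \<alpha>') \<le> g (x + s *\<^sub>R u)"
  obtains W where "open W" "convex W" "0 \<in> W"
    "\<And>s r w. 0 \<le> s \<Longrightarrow> 0 \<le> r \<Longrightarrow> w \<in> W \<Longrightarrow>
       ereal (c - \<epsilon> + s * \<alpha> - \<epsilon> * r) \<le> g (x + s *\<^sub>R u + r *\<^sub>R w)"
proof -
  \<comment> \<open>At this parameter the slope gap \<open>s0 * (\<alpha>' - \<alpha>)\<close>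
    exceeds \<open>\<epsilon>\<close>, so the bound with slope \<open>\<alpha>\<close> holds there
    without the loss of \<open>\<epsilon>\<close>.\<close>
  define s0 where "s0 = (\<epsilon> + 1) / (\<alpha>' - \<alpha>)"
  have s0: "0 < s0" "\<epsilon> < s0 * \<alpha>' - s0 * \<alpha>"
  proof -
    have "s0 * (\<alpha>' - \<alpha>) = \<epsilon> + 1" using \<alpha> by (simp add: s0_def)
    then show "\<epsilon> < s0 * \<alpha>' - s0 * \<alpha>" by (simp add: right_diff_distrib)
  qed (use \<epsilon> \<alpha> in \<open>simp add: s0_def\<close>)
  \<comment> \<open>The intermediate real \<open>\<kappa>\<close> exhibits the strict inequality
    between a continuous and an lsc function as a union of open conditions.\<close>
  define Q where "Q = (\<Union>\<kappa>. (\<lambda>p. x + snd p *\<^sub>R u + fst p) -` {y. ereal \<kappa> < g y} \<inter>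
    (\<lambda>p. c - \<epsilon> + snd p * \<alpha>) -` {..<\<kappa>})"
  have "open Q"
    unfolding Q_def
    by (intro open_UN ballI open_Int open_vimage lsc_fn_open[OF lsc] lc_tvs_continuous_scaleR
        lc_tvs_continuous_add lc continuous_intros open_lessThan)
  moreover have "{0} \<times> {0..s0} \<subseteq> Q"
  proof clarify
    fix s assume s: "s \<in> {0..s0}"
    have "ereal (c - \<epsilon> + s * \<alpha>) < g (x + s *\<^sub>R u)"
    proof (cases "s = 0")
      case True
      then show ?thesis using gx \<epsilon> by simp
    next
      case False
      with s have "0 < s" by simp
      then have "ereal (c - \<epsilon> + s * \<alpha>) < ereal (c - \<epsilon> + s * \<alpha>')"
        using \<alpha> by simp
      with ray[OF \<open>0 < s\<close>] show ?thesis by (rule less_le_trans[rotated])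
    qed
    from ereal_dense2[OF this] obtain \<kappa> where "ereal (c - \<epsilon> + s * \<alpha>) < ereal \<kappa>" "ereal \<kappa> < g (x + s *\<^sub>R u)"
      by blast
    then show "(0, s) \<in> Q"
      unfolding Q_def by auto
  qed
  ultimately obtain W1 where W1: "0 \<in> W1" "open W1" "W1 \<times> {0..s0} \<subseteq> Q"
    using Elementary_Topology.tube_lemma[of "{0..s0}" Q 0] by auto
  define W2 where "W2 = (\<lambda>w. (x + s0 *\<^sub>R u) + w) -` {y. ereal (c + s0 * \<alpha>) < g y}"
  have "open W2"
    unfolding W2_def
    by (intro open_vimage lsc_fn_open[OF lsc] lc_tvs_continuous_add lc continuous_intros)
  moreover have "0 \<in> W2"
  proof -
    have "ereal (c + s0 * \<alpha>) < ereal (c - \<epsilon> + s0 * \<alpha>')" using s0 by simp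
    with ray[OF s0(1)] have "ereal (c + s0 * \<alpha>) < g (x + s0 *\<^sub>R u)"
      by (rule less_le_trans[rotated])
    then show ?thesis by (simp add: W2_def)
  qed
  ultimately have "open (W1 \<inter> W2)" "0 \<in> W1 \<inter> W2"
    using W1 by auto
  then obtain W where W: "open W" "convex W" "0 \<in> W" "W \<subseteq> W1 \<inter> W2"
    using lc unfolding lc_tvs_def by blast
  have near: "ereal (c - \<epsilon> + s * \<alpha>) < g (x + s *\<^sub>R u + w)" if sw: "0 \<le> s" "s \<le> s0" "w \<in> W" for s w
  proof -
    have "(w, s) \<in> Q" using W1(3) W(4) sw by auto
    then obtain \<kappa> where k: "ereal \<kappa> < g (x + s *\<^sub>R u + w)" "c - \<epsilon> + s * \<alpha> < \<kappa>"
      unfolding Q_def by auto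
    have "ereal (c - \<epsilon> + s * \<alpha>) < ereal \<kappa>" using k(2) by simp
    then show ?thesis using k(1) by (rule less_trans)
  qed
  have far: "ereal (c + s0 * \<alpha>) < g (x + s0 *\<^sub>R u + w)" if "w \<in> W" for w
    using that W(4) unfolding W2_def by auto
  have "ereal (c - \<epsilon> + s * \<alpha> - \<epsilon> * r) \<le> g (x + s *\<^sub>R u + r *\<^sub>R w)"
    if s: "0 \<le> s" and r: "0 \<le> r" and w: "w \<in> W" for s r w
  proof (rule ccontr)
    define d where "d = c - \<epsilon> + s * \<alpha> - \<epsilon> * r"
    \<comment> \<open>The least factor \<open>\<ge> 1\<close> by which dividing brings
      \<open>r\<close> below 1 and \<open>s\<close> below \<open>s0\<close>, up to equality.\<close>
    define m where "m = max 1 (max r (s / s0))"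
    assume "\<not> ?thesis"
    then have less: "g (x + s *\<^sub>R u + r *\<^sub>R w) \<le> ereal d"
      by (simp add: d_def)
    have m: "1 \<le> m" "r \<le> m" "s / s0 \<le> m" by (auto simp: m_def)
    have "(r / m) *\<^sub>R w \<in> W"
      using convexD[OF W(2) w W(3), of "r / m" "1 - r / m"] m r by simp
    note w' = this
    have s': "0 \<le> s / m" "s / m \<le> s0"
      using m s s0(1) by (auto simp: field_simps)
    have "(1 / m) *\<^sub>R (x + s *\<^sub>R u + r *\<^sub>R w) + (1 - 1 / m) *\<^sub>R x
        = x + (s / m) *\<^sub>R u + (r / m) *\<^sub>R w"
      by (simp add: algebra_simps)
    then have up: "g (x + (s / m) *\<^sub>R u + (r / m) *\<^sub>R w) \<le> ereal ((1 / m) * d + (1 - 1 / m) * c)"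
      using convex_fn_le[OF cvx less, of x c "1 / m"] gx m by simp
    from less_le_trans[OF near[OF s' w'] up]
    have "c - \<epsilon> + s / m * \<alpha> < 1 / m * d + (1 - 1 / m) * c" by simp
    then have "m * (c - \<epsilon> + s / m * \<alpha>) < m * (1 / m * d + (1 - 1 / m) * c)"
      using m by simp
    then have "\<epsilon> * (1 + r) < \<epsilon> * m"
      using m by (simp add: d_def algebra_simps)
    \<comment> \<open>As \<open>1 + r\<close> dominates both 1 and \<open>r\<close>, the maximum
      must be \<open>s / s0\<close>; the pulled-back point then sits at \<open>s0\<close>, where the
      sharper bound \<open>far\<close> applies.\<close>
    then have "1 + r < m" using \<epsilon> by simp
    then have ms: "m = s / s0" using r by (auto simp: m_def)
    then have sm: "s / m = s0"
      using m s0(1) by (auto simp: field_simps)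
    from less_le_trans[OF far[OF w'] up[unfolded sm]]
    have "c + s0 * \<alpha> < 1 / m * d + (1 - 1 / m) * c" by simp
    then have "m * (c + s0 * \<alpha>) < m * (1 / m * d + (1 - 1 / m) * c)"
      using m by simp
    moreover have "m * s0 = s" using ms s0(1) by simp
    ultimately have "\<epsilon> * (1 + r) < 0"
      using m by (simp add: d_def algebra_simps)
    then show False using \<epsilon> r by (simp add: mult_less_0_iff)
  qed
  with W that show thesis by blast
qed

text \<open>The support function of the \<open>\<epsilon>\<close>-subdifferential dominates the \<open>\<epsilon>\<close>-directional
  derivative \<open>inf\<^bsub>s>0\<^esub> (g (x + s u) - g x + \<epsilon>) / s\<close>.\<close>

lemma eps_subdiff_support:
  fixes g :: "'a::{real_vector,t2_space} \<Rightarrow> ereal"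
  assumes lc: "lc_tvs TYPE('a)" and cvx: "convex_fn g" and lsc: "lsc_fn g"
    and gx: "g x = ereal c" and \<epsilon>: "0 < \<epsilon>"
    and sup: "\<And>a. a \<in> eps_subdiff \<epsilon> g x \<Longrightarrow> a u \<le> \<alpha>" and \<alpha>: "\<alpha> < \<alpha>'"
  obtains s where "0 < s" "g (x + s *\<^sub>R u) < ereal (c - \<epsilon> + s * \<alpha>')"
proof (rule ccontr)
  assume "\<not> thesis"
  with that have ray: "\<And>s. 0 < s \<Longrightarrow> ereal (c - \<epsilon> + s * \<alpha>') \<le> g (x + s *\<^sub>R u)"
    by (meson linorder_not_le)
  \<comment> \<open>The slope from \<open>\<alpha>'\<close> down to \<open>\<beta>\<close> pays for
    uniformity in \<open>W\<close>, and \<open>\<alpha> < \<beta>\<close> remains for the final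
    contradiction.\<close>
  define \<beta> where "\<beta> = (\<alpha> + \<alpha>') / 2"
  have \<beta>: "\<alpha> < \<beta>" "\<beta> < \<alpha>'" using \<alpha> by (auto simp: \<beta>_def)
  obtain W where W: "open W" "convex W" "0 \<in> W" and
    low: "\<And>s r w. 0 \<le> s \<Longrightarrow> 0 \<le> r \<Longrightarrow> w \<in> W \<Longrightarrow>
       ereal (c - \<epsilon> + s * \<beta> - \<epsilon> * r) \<le> g (x + s *\<^sub>R u + r *\<^sub>R w)"
    using convex_lsc_lower_bound_near_ray[OF lc cvx lsc gx \<epsilon> \<beta>(2) ray] by blast
  \<comment> \<open>The cone encodes \<open>f z \<le> k - c + \<epsilon>\<close> for every
    \<open>(x + z, k)\<close> in the epigraph, which is the subgradient inequality, and
    \<open>f (- w) \<le> \<epsilon>\<close> on \<open>W\<close>, which gives continuity.\<close>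
  define P where "P = {(\<tau> *\<^sub>R z - r *\<^sub>R w, \<tau> * (k - c + \<epsilon>) + r * \<epsilon>) | \<tau> z r w k.
    0 \<le> \<tau> \<and> 0 \<le> r \<and> w \<in> W \<and> g (x + z) \<le> ereal k}"
  have PI: "(v, t) \<in> P" if "0 \<le> \<tau>" "0 \<le> r" "w \<in> W" "g (x + z) \<le> ereal k"
    "v = \<tau> *\<^sub>R z - r *\<^sub>R w" "t = \<tau> * (k - c + \<epsilon>) + r * \<epsilon>" for v t \<tau> z r w k
    unfolding P_def using that by blast
  have mix: "\<exists>l. 0 \<le> l \<and> l \<le> 1 \<and> (a + b) * l = a \<and> (a + b) * (1 - l) = b"
    if "0 \<le> a" "0 \<le> b" for a b :: real
    using that
    by (intro exI[of _ "a / (a + b)"], cases "a + b = 0") (auto simp: field_simps)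
  have cone: "convex_cone P"
    unfolding convex_cone_iff
  proof (intro conjI ballI allI impI)
    show "0 \<in> P"
      unfolding zero_prod_def using W(3) gx by (intro PI[of 0 0 0 0 c]) auto
  next
    fix p q assume "p \<in> P" "q \<in> P"
    then obtain \<tau> z r w k \<tau>' z' r' w' k' where
      p: "p = (\<tau> *\<^sub>R z - r *\<^sub>R w, \<tau> * (k - c + \<epsilon>) + r * \<epsilon>)"
        "0 \<le> \<tau>" "0 \<le> r" "w \<in> W" "g (x + z) \<le> ereal k" and
      q: "q = (\<tau>' *\<^sub>R z' - r' *\<^sub>R w', \<tau>' * (k' - c + \<epsilon>) + r' * \<epsilon>)"
        "0 \<le> \<tau>'" "0 \<le> r'" "w' \<in> W" "g (x + z') \<le> ereal k'"
      unfolding P_def by blast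
    obtain l where l: "0 \<le> l" "l \<le> 1" "(\<tau> + \<tau>') * l = \<tau>" "(\<tau> + \<tau>') * (1 - l) = \<tau>'"
      using mix p(2) q(2) by blast
    obtain m where m: "0 \<le> m" "m \<le> 1" "(r + r') * m = r" "(r + r') * (1 - m) = r'"
      using mix p(3) q(3) by blast
    have w'': "m *\<^sub>R w + (1 - m) *\<^sub>R w' \<in> W"
      using convexD[OF W(2) p(4) q(4)] m by simp
    have "l *\<^sub>R (x + z) + (1 - l) *\<^sub>R (x + z') = x + (l *\<^sub>R z + (1 - l) *\<^sub>R z')"
      by (simp add: algebra_simps)
    then have z'': "g (x + (l *\<^sub>R z + (1 - l) *\<^sub>R z')) \<le> ereal (l * k + (1 - l) * k')"
      using convex_fn_le[OF cvx p(5) q(5) l(1,2)] by simp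
    have comb: "(\<tau> + \<tau>') *\<^sub>R (l *\<^sub>R z + (1 - l) *\<^sub>R z') = \<tau> *\<^sub>R z + \<tau>' *\<^sub>R z'"
      "(r + r') *\<^sub>R (m *\<^sub>R w + (1 - m) *\<^sub>R w') = r *\<^sub>R w + r' *\<^sub>R w'"
      "(\<tau> + \<tau>') * (l * k + (1 - l) * k') = \<tau> * k + \<tau>' * k'"
      unfolding scaleR_add_right scaleR_scaleR l(3,4) m(3,4) distrib_left
      by (simp_all only: mult.assoc[symmetric] l(3,4))
    show "p + q \<in> P"
      unfolding p(1) q(1) plus_prod_def fst_conv snd_conv
    proof (rule PI[OF _ _ w'' z''])
      show "\<tau> *\<^sub>R z - r *\<^sub>R w + (\<tau>' *\<^sub>R z' - r' *\<^sub>R w') =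
        (\<tau> + \<tau>') *\<^sub>R (l *\<^sub>R z + (1 - l) *\<^sub>R z') - (r + r') *\<^sub>R (m *\<^sub>R w + (1 - m) *\<^sub>R w')"
        unfolding comb by simp
      have "(\<tau> + \<tau>') * (l * k + (1 - l) * k' - c + \<epsilon>) =
          (\<tau> + \<tau>') * (l * k + (1 - l) * k') + (\<tau> + \<tau>') * (\<epsilon> - c)"
        by (simp add: right_diff_distrib distrib_left)
      then show "\<tau> * (k - c + \<epsilon>) + r * \<epsilon> + (\<tau>' * (k' - c + \<epsilon>) + r' * \<epsilon>) =
        (\<tau> + \<tau>') * (l * k + (1 - l) * k' - c + \<epsilon>) + (r + r') * \<epsilon>"
        unfolding comb by (simp add: algebra_simps)
    qed (use p q in auto)
  next
    fix p and b :: real assume "p \<in> P" "0 \<le> b"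
    then obtain \<tau> z r w k where
      p: "p = (\<tau> *\<^sub>R z - r *\<^sub>R w, \<tau> * (k - c + \<epsilon>) + r * \<epsilon>)"
        "0 \<le> \<tau>" "0 \<le> r" "w \<in> W" "g (x + z) \<le> ereal k"
      unfolding P_def by blast
    then show "b *\<^sub>R p \<in> P"
      unfolding p(1) scaleR_prod_def fst_conv snd_conv using \<open>0 \<le> b\<close>
      by (intro PI[of "b * \<tau>" "b * r" w z k]) (auto simp: algebra_simps)
  qed
  \<comment> \<open>The case \<open>\<sigma> = 0\<close> is consistency of the cone and
    \<open>\<sigma> = 1\<close> permits the requirement \<open>\<beta> \<le> f u\<close>.\<close>
  have bound: "\<sigma> * \<beta> \<le> t" if st: "(\<sigma> *\<^sub>R u, t) \<in> P" "0 \<le> \<sigma>" for \<sigma> t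
  proof -
    obtain \<tau> z r w k where
      p: "\<sigma> *\<^sub>R u = \<tau> *\<^sub>R z - r *\<^sub>R w" "t = \<tau> * (k - c + \<epsilon>) + r * \<epsilon>"
        "0 \<le> \<tau>" "0 \<le> r" "w \<in> W" "g (x + z) \<le> ereal k"
      using st(1) unfolding P_def by blast
    show ?thesis
    proof (cases "\<tau> = 0")
      case False
      with p(3) have "0 < \<tau>" by simp
      have "\<tau> *\<^sub>R z = \<sigma> *\<^sub>R u + r *\<^sub>R w" using p(1) by simp
      then have "(1 / \<tau>) *\<^sub>R (\<tau> *\<^sub>R z) = (1 / \<tau>) *\<^sub>R (\<sigma> *\<^sub>R u + r *\<^sub>R w)" by simp
      then have "x + z = x + (\<sigma> / \<tau>) *\<^sub>R u + (r / \<tau>) *\<^sub>R w"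
        using \<open>0 < \<tau>\<close> by (simp add: scaleR_add_right)
      then have "ereal (c - \<epsilon> + \<sigma> / \<tau> * \<beta> - \<epsilon> * (r / \<tau>)) \<le> g (x + z)"
        using low[of "\<sigma> / \<tau>" "r / \<tau>" w] p(4,5) \<open>0 < \<tau>\<close> st(2) by (simp add: add.assoc)
      then have "ereal (c - \<epsilon> + \<sigma> / \<tau> * \<beta> - \<epsilon> * (r / \<tau>)) \<le> ereal k"
        using p(6) by (rule order_trans)
      then have "\<tau> * (c - \<epsilon> + \<sigma> / \<tau> * \<beta> - \<epsilon> * (r / \<tau>)) \<le> \<tau> * k"
        using \<open>0 < \<tau>\<close> by simp
      then show ?thesis
        using \<open>0 < \<tau>\<close> by (simp add: p(2) algebra_simps)
    next
      case True
      show ?thesis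
      proof (rule ccontr)
        \<comment> \<open>Without an epigraph part the displacement \<open>\<sigma> u + r w\<close>
          is zero, so \<open>low\<close> at its multiples bounds \<open>s * h\<close> by
          \<open>\<epsilon>\<close> for every \<open>s > 0\<close>; the choice
          \<open>2 * \<epsilon> / h\<close> violates this.\<close>
        define h where "h = \<sigma> * \<beta> - \<epsilon> * r"
        assume "\<not> ?thesis"
        then have h: "0 < h" using True p(2) by (simp add: h_def mult.commute)
        define s where "s = 2 * \<epsilon> / h"
        have "0 < s" using h \<epsilon> by (simp add: s_def)
        have "\<sigma> *\<^sub>R u + r *\<^sub>R w = 0" using p(1) True by simp
        then have "s *\<^sub>R (\<sigma> *\<^sub>R u + r *\<^sub>R w) = 0" by simp
        then have "x + (s * \<sigma>) *\<^sub>R u + (s * r) *\<^sub>R w = x"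
          by (simp add: scaleR_add_right add.assoc)
        then have "c - \<epsilon> + (s * \<sigma>) * \<beta> - \<epsilon> * (s * r) \<le> c"
          using low[of "s * \<sigma>" "s * r" w] p(4,5) st(2) \<open>0 < s\<close> gx by (simp add: add.assoc)
        then have "s * h \<le> \<epsilon>"
          by (simp add: h_def algebra_simps)
        then show False using h \<epsilon> by (simp add: s_def)
      qed
    qed
  qed
  have "0 \<le> t" if "(0, t) \<in> P" for t
    using bound[of 0 t] that by simp
  moreover have "\<exists>t. (v, t) \<in> P" for v
  proof -
    obtain k where k: "0 < k" "k *\<^sub>R (- v) \<in> W"
      using lc_tvs_absorbing[OF lc W(1,3)] by blast
    then have "(v, 1 / k * \<epsilon>) \<in> P"
      using gx by (intro PI[of 0 "1 / k" "k *\<^sub>R (- v)" 0 c]) auto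
    then show ?thesis by blast
  qed
  moreover have "\<beta> \<le> t" if "(u, t) \<in> P" for t
    using bound[of 1 t] that by simp
  ultimately obtain f where f: "linear f" "\<And>v t. (v, t) \<in> P \<Longrightarrow> f v \<le> t" "\<beta> \<le> f u"
    using convex_cone_linear_minorant_ge[OF cone] by blast
  have "- \<epsilon> \<le> f w" if "w \<in> W" for w
  proof -
    have "(- w, \<epsilon>) \<in> P"
      using that gx by (intro PI[of 0 1 w 0 c]) auto
    then show ?thesis
      using f(2) linear_neg[OF f(1), of w] by fastforce
  qed
  then have "continuous_on UNIV f"
    by (rule lc_tvs_linear_continuous[OF lc f(1) W(1,3)])
  moreover have "ereal (c + f (y - x) - \<epsilon>) \<le> g y" for y
  proof (rule ereal_le_real)
    fix k assume "g y \<le> ereal k"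
    then have "(y - x, k - c + \<epsilon>) \<in> P"
      using W(3) by (intro PI[of 1 0 0 "y - x" k]) auto
    from f(2)[OF this] show "ereal (c + f (y - x) - \<epsilon>) \<le> ereal k" by simp
  qed
  ultimately have "f \<in> eps_subdiff \<epsilon> g x"
    using f(1) gx by (simp add: eps_subdiff_def dual_def)
  from sup[OF this] f(3) \<beta>(1) show False by simp
qed

text \<open>For an empty set the support estimate holds with any bound; in the direction 0 it would
  give \<open>g x < c - \<epsilon>\<close>.\<close>

corollary eps_subdiff_nonempty:
  fixes g :: "'a::{real_vector,t2_space} \<Rightarrow> ereal"
  assumes "lc_tvs TYPE('a)" "convex_fn g" "lsc_fn g" and gx: "g x = ereal c" and \<epsilon>: "0 < \<epsilon>"
  shows "eps_subdiff \<epsilon> g x \<noteq> {}"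
proof
  assume "eps_subdiff \<epsilon> g x = {}"
  then obtain s where "0 < s" "g (x + s *\<^sub>R 0) < ereal (c - \<epsilon> + s * 0)"
    using eps_subdiff_support[OF assms, of 0 "- 1" 0] by auto
  then show False using gx \<epsilon> by simp
qed

section \<open>Suprema of compactly indexed families\<close>

text \<open>Evaluation at \<open>z\<close> is weak* continuous, so the half-space it cuts out of the
  dual is one of the sets intersected in \<open>wcco\<close>. This carries inequalities from a set
  to its hull.\<close>

lemma wcco_halfspace:
  assumes A: "\<And>a. a \<in> A \<Longrightarrow> a \<in> dual \<and> a z \<le> k" and \<phi>: "\<phi> \<in> wcco A"
  shows "\<phi> \<in> dual" "\<phi> z \<le> k"
proof -
  define C where "C = {a \<in> dual. a z \<le> k}"
  have "closed {a :: 'a \<Rightarrow> real. a z \<le> k}"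
    by (intro closed_Collect_le continuous_intros) auto
  then have "closedin weak_star C"
    unfolding weak_star_def C_def closedin_subtopology by auto
  moreover have "fconvex C"
    unfolding fconvex_def
  proof (intro ballI allI impI)
    fix a b and u :: real
    assume "a \<in> C" "b \<in> C" and u: "0 \<le> u \<and> u \<le> 1"
    then have ab: "linear a" "continuous_on UNIV a" "a z \<le> k" "linear b" "continuous_on UNIV b" "b z \<le> k"
      by (auto simp: C_def dual_def)
    have "linear (\<lambda>y. u * a y + (1 - u) * b y)"
      using ab(1,4) by (intro linearI) (auto simp: linear_add linear_cmul algebra_simps)
    moreover have "continuous_on UNIV (\<lambda>y. u * a y + (1 - u) * b y)"
      using ab(2,5) by (intro continuous_intros)
    moreover have "u * a z + (1 - u) * b z \<le> k"
      using convex_bound_le[OF ab(3,6), of u "1 - u"] u by simp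
    ultimately show "(\<lambda>y. u * a y + (1 - u) * b y) \<in> C"
      by (simp add: C_def dual_def)
  qed
  moreover have "A \<subseteq> C"
    using A by (auto simp: C_def)
  ultimately have "wcco A \<subseteq> C"
    unfolding wcco_def by blast
  with \<phi> show "\<phi> \<in> dual" "\<phi> z \<le> k" by (auto simp: C_def)
qed

lemma wcco_separation:
  assumes \<phi>: "\<phi> \<in> dual" "\<phi> \<notin> wcco A"
  obtains u \<alpha> where "\<alpha> < \<phi> u" "\<And>a. a \<in> A \<Longrightarrow> a u \<le> \<alpha>"
proof -
  obtain C where C: "A \<subseteq> C" "fconvex C" "closedin weak_star C" "\<phi> \<notin> C"
    using \<phi>(2) unfolding wcco_def by blast
  show thesis
  proof (rule weak_star_separation[OF C(3,2) \<phi>(1) C(4)])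
    fix u \<alpha> assume "\<alpha> < \<phi> u" "\<And>c. c \<in> C \<Longrightarrow> c u \<le> \<alpha>"
    then show thesis using C(1) by (intro that) auto
  qed
qed

text \<open>Since \<open>Q\<close> holds locally for all parameters up to the radius, the minimum
  over a finite subcover works everywhere; the inserted 1 covers an empty subcover.\<close>

lemma compact_space_uniform_radius:
  fixes Q :: "'i \<Rightarrow> real \<Rightarrow> bool"
  assumes cpt: "compact_space X"
    and loc: "\<And>t. t \<in> topspace X \<Longrightarrow>
      \<exists>U r. openin X U \<and> t \<in> U \<and> 0 < r \<and> (\<forall>\<tau>\<in>U. \<forall>s. 0 < s \<longrightarrow> s \<le> r \<longrightarrow> Q \<tau> s)"
  obtains r where "0 < r" "\<And>t. t \<in> topspace X \<Longrightarrow> Q t r"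
proof -
  define R where "R = (\<lambda>t U r. openin X U \<and> t \<in> U \<and> 0 < r \<and> (\<forall>\<tau>\<in>U. \<forall>s. 0 < s \<longrightarrow> s \<le> r \<longrightarrow> Q \<tau> s))"
  have "\<forall>t\<in>topspace X. \<exists>U r. R t U r"
    using loc unfolding R_def by blast
  then obtain U r where "\<And>t. t \<in> topspace X \<Longrightarrow> R t (U t) (r t)"
    by metis
  note U = this[unfolded R_def]
  have "\<exists>\<F>. finite \<F> \<and> \<F> \<subseteq> U ` topspace X \<and> topspace X \<subseteq> \<Union>\<F>"
    using U by (intro cpt[unfolded compact_space_alt, rule_format]) blast
  then obtain I where I: "finite I" "I \<subseteq> topspace X" "topspace X \<subseteq> \<Union>(U ` I)"
    by (metis finite_subset_image)
  define m where "m = Min (insert 1 (r ` I))"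
  have "0 < m" "\<And>i. i \<in> I \<Longrightarrow> m \<le> r i"
    using I(1,2) U by (auto simp: m_def)
  then show thesis
    using I U by (intro that[of m]) blast+
qed

section \<open>Arithmetic of dual functionals and approximate subgradients\<close>

lemma msum_iff: "\<psi> \<in> msum A B \<longleftrightarrow> (\<exists>a\<in>A. \<exists>b\<in>B. \<psi> = (\<lambda>z. a z + b z))"
  by (auto simp: msum_def)

lemma smul_iff: "\<psi> \<in> smul L A \<longleftrightarrow> (\<exists>a\<in>A. \<exists>l\<in>L. \<psi> = (\<lambda>z. l * a z))"
  unfolding smul_def by blast

lemma dual_zero: "(\<lambda>_. 0) \<in> dual"
  by (simp add: dual_def linear_zero)

lemma dual_add: "a \<in> dual \<Longrightarrow> b \<in> dual \<Longrightarrow> (\<lambda>z. a z + b z) \<in> dual"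
  by (auto simp: dual_def intro: linear_compose_add continuous_on_add)

lemma dual_mult: "a \<in> dual \<Longrightarrow> (\<lambda>z. l * a z) \<in> dual"
  by (auto simp: dual_def linear_iff algebra_simps intro: continuous_on_mult_left)

lemma eps_subdiffD:
  assumes "a \<in> eps_subdiff \<epsilon> g x"
  shows "a \<in> dual" "g x = ereal c \<Longrightarrow> ereal (c + a (y - x) - \<epsilon>) \<le> g y"
  using assms by (auto simp: eps_subdiff_def split: if_splits)

lemma eps_subdiff_mult:
  assumes a: "a \<in> eps_subdiff (\<epsilon> / \<rho>) g x" and gx: "g x = ereal c" and \<rho>: "0 < \<rho>"
  shows "(\<lambda>z. \<rho> * a z) \<in> eps_subdiff \<epsilon> (\<lambda>y. ereal \<rho> * g y) x"
proof -
  have "ereal (\<rho> * c + \<rho> * a (y - x) - \<epsilon>) \<le> ereal \<rho> * g y" for y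
  proof -
    have "ereal \<rho> * ereal (c + a (y - x) - \<epsilon> / \<rho>) \<le> ereal \<rho> * g y"
      using eps_subdiffD(2)[OF a gx] \<rho> by (intro ereal_mult_left_mono) auto
    then show ?thesis using \<rho> by (simp add: algebra_simps)
  qed
  then show ?thesis
    using dual_mult[OF eps_subdiffD(1)[OF a]] gx by (auto simp: eps_subdiff_def)
qed

text \<open>A direction bounding the sum set from above bounds the \<open>\<epsilon>\<close>-derivatives of the active
  functions by \<open>\<alpha>\<close>, while for the inactive ones it only yields finiteness at one point of the ray;
  continuity of convex functions along the ray keeps these below the supremum nearby.\<close>

lemma sup_ray_bound:
  fixes F :: "'i \<Rightarrow> 'a::{real_vector,t2_space} \<Rightarrow> ereal" and c \<alpha> \<epsilon> :: real
  assumes cpt: "compact_space TT"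
    and cvx: "\<And>t. t \<in> topspace TT \<Longrightarrow> convex_fn (F t)"
    and usc: "\<And>z c. openin TT {t \<in> topspace TT. F t z < c}"
    and le: "\<And>t. t \<in> topspace TT \<Longrightarrow> F t x \<le> ereal c"
    and \<epsilon>: "0 < \<epsilon>"
    and active: "\<And>t. t \<in> topspace TT \<Longrightarrow> F t x = ereal c \<Longrightarrow>
      \<exists>s>0. F t (x + s *\<^sub>R u) < ereal (c - \<epsilon> + s * \<alpha>)"
    and inactive: "\<And>t. t \<in> topspace TT \<Longrightarrow> F t x \<noteq> ereal c \<Longrightarrow>
      \<exists>s>0. F t (x + s *\<^sub>R u) < \<infinity>"
  obtains s where "0 < s" "\<And>t. t \<in> topspace TT \<Longrightarrow> F t (x + s *\<^sub>R u) \<le> ereal (c + s * \<alpha>)"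
proof (rule compact_space_uniform_radius[OF cpt, where Q = "\<lambda>t s. F t (x + s *\<^sub>R u) \<le> ereal (c + s * \<alpha>)"])
  fix t assume t: "t \<in> topspace TT"
  show "\<exists>U r. openin TT U \<and> t \<in> U \<and> 0 < r \<and>
      (\<forall>\<tau>\<in>U. \<forall>s. 0 < s \<longrightarrow> s \<le> r \<longrightarrow> F \<tau> (x + s *\<^sub>R u) \<le> ereal (c + s * \<alpha>))"
  proof (cases "F t x = ereal c")
    case True
    obtain r where r: "0 < r" "F t (x + r *\<^sub>R u) < ereal (c - \<epsilon> + r * \<alpha>)"
      using active[OF t True] by blast
    \<comment> \<open>Nearby indices need not be active: the chord estimate uses only
      \<open>F \<tau> x \<le> c\<close> and the strict inequality at \<open>r\<close>.\<close>
    define U where "U = {\<tau> \<in> topspace TT. F \<tau> (x + r *\<^sub>R u) < ereal (c - \<epsilon> + r * \<alpha>)}"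
    have "F \<tau> (x + s *\<^sub>R u) \<le> ereal (c + s * \<alpha>)" if "\<tau> \<in> U" "0 < s" "s \<le> r" for \<tau> s
    proof -
      have "F \<tau> (x + s *\<^sub>R u) \<le> ereal (c + s / r * (c - \<epsilon> + r * \<alpha> - c))"
        using that r(1) by (intro convex_fn_ray_le cvx le) (auto simp: U_def)
      also have "c + s / r * (c - \<epsilon> + r * \<alpha> - c) = c + s * \<alpha> - s / r * \<epsilon>"
        using r(1) by (simp add: field_simps)
      also have "ereal \<dots> \<le> ereal (c + s * \<alpha>)"
        using that r(1) \<epsilon> by simp
      finally show ?thesis .
    qed
    then show ?thesis
      using usc r t by (intro exI[of _ U] exI[of _ r]) (auto simp: U_def)
  next
    case False
    then have "F t x < ereal c" using le[OF t] by simp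
    then obtain p where p: "F t x < ereal p" "p < c"
      using ereal_dense2[of "F t x" "ereal c"] by auto
    obtain r where r: "0 < r" "F t (x + r *\<^sub>R u) < \<infinity>"
      using inactive[OF t False] by blast
    then obtain q where q: "F t (x + r *\<^sub>R u) < ereal q"
      using ereal_dense2[of "F t (x + r *\<^sub>R u)" \<infinity>] by auto
    define U where "U = {\<tau> \<in> topspace TT. F \<tau> x < ereal p} \<inter> {\<tau> \<in> topspace TT. F \<tau> (x + r *\<^sub>R u) < ereal q}"
    define K where "K = \<bar>(q - p) / r\<bar> + \<bar>\<alpha>\<bar> + 1"
    have K: "0 < K" unfolding K_def by linarith
    define \<delta> where "\<delta> = min r ((c - p) / K)"
    have \<delta>: "0 < \<delta>" using p(2) r(1) K by (simp add: \<delta>_def)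
    have "F \<tau> (x + s *\<^sub>R u) \<le> ereal (c + s * \<alpha>)" if "\<tau> \<in> U" "0 < s" "s \<le> \<delta>" for \<tau> s
    proof -
      have "F \<tau> (x + s *\<^sub>R u) \<le> ereal (p + s / r * (q - p))"
        using that r(1) by (intro convex_fn_ray_le cvx) (auto simp: U_def \<delta>_def)
      also have "p + s / r * (q - p) \<le> c + s * \<alpha>"
      proof -
        have "s * K \<le> c - p"
          using that(3) K by (simp add: \<delta>_def pos_le_divide_eq)
        moreover have "s * ((q - p) / r - \<alpha>) \<le> s * K"
          using that(2) unfolding K_def by (intro mult_left_mono) linarith+
        ultimately show ?thesis by (simp add: algebra_simps)
      qed
      finally show ?thesis by simp
    qed
    moreover have "openin TT U"
      unfolding U_def by (intro openin_Int usc)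
    ultimately show ?thesis
      using p q t \<delta> by (intro exI[of _ U] exI[of _ \<delta>]) (auto simp: U_def)
  qed
qed (use that in blast)

text \<open>If no index attained the supremum, each would leave a gap that persists nearby by upper
  semicontinuity; compactness makes the gap uniform, which lowers the supremum.\<close>

lemma usc_sup_attained:
  fixes h :: "'i \<Rightarrow> ereal"
  assumes cpt: "compact_space TT"
    and usc: "\<And>c. openin TT {t \<in> topspace TT. h t < c}"
    and sup: "(SUP t\<in>topspace TT. h t) = ereal c"
  obtains t where "t \<in> topspace TT" "h t = ereal c"
proof (rule ccontr)
  assume "\<not> thesis"
  then have less: "h t < ereal c" if "t \<in> topspace TT" for t
    using SUP_upper[OF that, of h] sup that \<open>\<And>t. t \<in> topspace TT \<Longrightarrow> h t = ereal c \<Longrightarrow> thesis\<close> by fastforce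
  obtain r where "0 < r" "\<And>t. t \<in> topspace TT \<Longrightarrow> h t \<le> ereal (c - r)"
  proof (rule compact_space_uniform_radius[OF cpt, where Q = "\<lambda>t s. h t \<le> ereal (c - s)"])
    fix t assume t: "t \<in> topspace TT"
    obtain p where p: "h t < ereal p" "p < c"
      using ereal_dense2[OF less[OF t]] by auto
    have "h \<tau> \<le> ereal (c - s)" if "h \<tau> < ereal p" "s \<le> c - p" for \<tau> s
      using that by (intro order_trans[OF less_imp_le[OF that(1)]]) simp
    then show "\<exists>U r. openin TT U \<and> t \<in> U \<and> 0 < r \<and> (\<forall>\<tau>\<in>U. \<forall>s. 0 < s \<longrightarrow> s \<le> r \<longrightarrow> h \<tau> \<le> ereal (c - s))"
      using usc p t
      by (intro exI[of _ "{\<tau> \<in> topspace TT. h \<tau> < ereal p}"] exI[of _ "c - p"]) auto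
  qed blast
  then have "ereal c \<le> ereal (c - r)"
    unfolding sup[symmetric] by (intro SUP_least)
  with \<open>0 < r\<close> show False by simp
qed

theorem theorem3:
  fixes F :: "'i \<Rightarrow> 'a::{real_vector,t2_space} \<Rightarrow> ereal"
    and TT :: "'i topology"
    and \<rho> :: "'i \<Rightarrow> real"
    and x :: 'a
  assumes X: "lc_tvs TYPE('a)"
    and Tne: "topspace TT \<noteq> {}"
    and fprop: "\<And>t. t \<in> topspace TT \<Longrightarrow> proper_fn (F t) \<and> convex_fn (F t) \<and> lsc_fn (F t)"
    and SH_cpt: "compact_space TT" and SH_T2: "Hausdorff_space TT"
    and SH_usc: "\<And>z c. openin TT {t \<in> topspace TT. F t z < c}"
    and xdom: "(SUP t\<in>topspace TT. F t x) < \<infinity>"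
    and rho: "\<And>t. t \<in> topspace TT \<Longrightarrow> 0 < \<rho> t \<and> \<rho> t \<le> 1"
    and rhoinf: "(INF t\<in>topspace TT. ereal (\<rho> t) * F t x) > -\<infinity>"
  shows "eps_subdiff 0 (\<lambda>y. SUP t\<in>topspace TT. F t y) x =
    (\<Inter>\<epsilon>\<in>{0<..}. wcco (msum
        (\<Union>t\<in>{t \<in> topspace TT. F t x = (SUP s\<in>topspace TT. F s x)}. eps_subdiff \<epsilon> (F t) x)
        (if {t \<in> topspace TT. F t x = (SUP s\<in>topspace TT. F s x)} = topspace TT then {(\<lambda>_. 0)}
         else \<Union>t\<in>topspace TT - {t \<in> topspace TT. F t x = (SUP s\<in>topspace TT. F s x)}.
                smul {0, \<epsilon>} (eps_subdiff \<epsilon> (\<lambda>y. ereal (\<rho> t) * F t y) x))))"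
proof -
  define T where "T = topspace TT"
  define f where "f = (\<lambda>y. SUP t\<in>T. F t y)"
  define A where "A = {t \<in> T. F t x = f x}"
  define B where "B = (\<lambda>\<epsilon>. if A = T then {(\<lambda>_. 0)}
    else \<Union>t\<in>T - A. smul {0, \<epsilon>} (eps_subdiff \<epsilon> (\<lambda>y. ereal (\<rho> t) * F t y) x))"
  define D where "D = (\<lambda>\<epsilon>. msum (\<Union>t\<in>A. eps_subdiff \<epsilon> (F t) x) (B \<epsilon>))"
  have upper: "F t y \<le> f y" if "t \<in> T" for t y
    unfolding f_def using that by (rule SUP_upper)
  have notminf: "F t y \<noteq> - \<infinity>" if "t \<in> T" for t y
    using fprop that unfolding T_def proper_fn_def by blast
  have fnotminf: "f y \<noteq> - \<infinity>" for y
    using Tne upper[of _ y] notminf[of _ y] unfolding T_def by fastforce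
  obtain c where c: "f x = ereal c"
    using xdom fnotminf[of x] unfolding f_def T_def by (metis ereal_cases less_irrefl)
  have le: "F t x \<le> ereal c" if "t \<in> T" for t
    using upper[OF that, of x] c by simp
  have fin: "\<exists>d. F t x = ereal d" if "t \<in> T" for t
    using le[OF that] notminf[OF that, of x] by (cases "F t x") auto
  have memB: "b \<in> B \<epsilon> \<longleftrightarrow> (if A = T then b = (\<lambda>_. 0) else
      \<exists>s\<in>T - A. \<exists>d\<in>eps_subdiff \<epsilon> (\<lambda>y. ereal (\<rho> s) * F s y) x. \<exists>l\<in>{0, \<epsilon>}. b = (\<lambda>z. l * d z))"
    for b \<epsilon>
    unfolding B_def by (cases "A = T") (simp_all only: refl if_True if_False UN_iff smul_iff singleton_iff)
  have memD: "\<psi> \<in> D \<epsilon> \<longleftrightarrow> (\<exists>t\<in>A. \<exists>a\<in>eps_subdiff \<epsilon> (F t) x. \<exists>b\<in>B \<epsilon>. \<psi> = (\<lambda>z. a z + b z))" for \<psi> \<epsilon>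
    unfolding D_def msum_iff by auto
  have B_dual: "b \<in> dual" if "b \<in> B \<epsilon>" for b \<epsilon>
    using that unfolding memB
    by (auto intro!: dual_mult dual_zero dest: eps_subdiffD(1) split: if_splits)
  have D_dual: "\<psi> \<in> dual" if "\<psi> \<in> D \<epsilon>" for \<psi> \<epsilon>
    using that unfolding memD by (auto intro: dual_add[OF eps_subdiffD(1) B_dual])

  \<comment> \<open>Subgradients of the supremum lie in every hull\<close>
  have "\<phi> \<in> wcco (D \<epsilon>)" if \<phi>: "\<phi> \<in> eps_subdiff 0 f x" and \<epsilon>: "0 < \<epsilon>" for \<phi> \<epsilon>
  proof (rule ccontr)
    assume "\<phi> \<notin> wcco (D \<epsilon>)"
    then obtain u \<alpha> where u: "\<alpha> < \<phi> u" "\<And>\<psi>. \<psi> \<in> D \<epsilon> \<Longrightarrow> \<psi> u \<le> \<alpha>"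
      using wcco_separation[OF eps_subdiffD(1)[OF \<phi>], of "D \<epsilon>"] by metis
    have DU: "a u + b u \<le> \<alpha>" if "t \<in> A" "a \<in> eps_subdiff \<epsilon> (F t) x" "b \<in> B \<epsilon>" for t a b
    proof -
      have "(\<lambda>z. a z + b z) \<in> D \<epsilon>" using that unfolding memD by blast
      from u(2)[OF this] show ?thesis .
    qed
    define \<alpha>' where "\<alpha>' = (\<alpha> + \<phi> u) / 2"
    have \<alpha>': "\<alpha> < \<alpha>'" "\<alpha>' < \<phi> u" using u(1) by (auto simp: \<alpha>'_def)
    obtain t0 where t0: "t0 \<in> A"
      using usc_sup_attained[OF SH_cpt SH_usc, of x c] c unfolding A_def f_def T_def by auto
    have nonempty: "eps_subdiff e (F t) x \<noteq> {}" if "t \<in> T" "0 < e" for t e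
      using fin[OF that(1)] fprop that eps_subdiff_nonempty[OF X] unfolding T_def by metis
    obtain a0 where a0: "a0 \<in> eps_subdiff \<epsilon> (F t0) x"
      using nonempty[of t0 \<epsilon>] t0 \<epsilon> unfolding A_def by auto
    have rho_sub: "(\<lambda>z. \<rho> t * a z) \<in> eps_subdiff \<epsilon> (\<lambda>y. ereal (\<rho> t) * F t y) x"
      if "t \<in> T" "a \<in> eps_subdiff (\<epsilon> / \<rho> t) (F t) x" for t a
      using fin[OF that(1)] rho that eps_subdiff_mult unfolding T_def by metis
    \<comment> \<open>The multiplier 0 makes the second summand vanish and isolates
      \<open>a\<close>. If inactive indices exist, this needs one of them to have a nonempty
      approximate subdifferential.\<close>
    have act: "a u \<le> \<alpha>" if t: "t \<in> A" "a \<in> eps_subdiff \<epsilon> (F t) x" for t a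
    proof (cases "A = T")
      case True
      then have "(\<lambda>_. 0) \<in> B \<epsilon>" unfolding memB by simp
      from DU[OF t this] show ?thesis by simp
    next
      case False
      then obtain s where s: "s \<in> T - A" unfolding A_def by blast
      then obtain b where "b \<in> eps_subdiff (\<epsilon> / \<rho> s) (F s) x"
        using nonempty[of s "\<epsilon> / \<rho> s"] rho \<epsilon> unfolding T_def by fastforce
      then have "(\<lambda>z. \<rho> s * b z) \<in> eps_subdiff \<epsilon> (\<lambda>y. ereal (\<rho> s) * F s y) x"
        using rho_sub s by blast
      then have "(\<lambda>z. 0 * (\<rho> s * b z)) \<in> B \<epsilon>"
        using s False unfolding memB if_not_P[OF False] by (intro bexI refl) auto
      from DU[OF t this] show ?thesis by simp
    qed
    \<comment> \<open>The multiplier \<open>\<epsilon>\<close> together with the fixed active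
      subgradient \<open>a0\<close> bounds the support function at \<open>u\<close>; the bound may
      depend on \<open>t\<close>, as only finiteness is drawn from it.\<close>
    have inact: "a u \<le> (\<alpha> - a0 u) / (\<epsilon> * \<rho> t)"
      if t: "t \<in> T - A" "a \<in> eps_subdiff (\<epsilon> / \<rho> t) (F t) x" for t a
    proof -
      have "(\<lambda>z. \<rho> t * a z) \<in> eps_subdiff \<epsilon> (\<lambda>y. ereal (\<rho> t) * F t y) x"
        using rho_sub t by blast
      moreover have "A \<noteq> T" using t(1) by blast
      ultimately have "(\<lambda>z. \<epsilon> * (\<rho> t * a z)) \<in> B \<epsilon>"
        using t(1) unfolding memB if_not_P[OF \<open>A \<noteq> T\<close>] by (intro bexI refl) auto
      from DU[OF t0 a0 this] have "a0 u + \<epsilon> * (\<rho> t * a u) \<le> \<alpha>" by simp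
      moreover have "0 < \<epsilon> * \<rho> t" using \<epsilon> rho t unfolding T_def by simp
      ultimately show ?thesis by (simp add: field_simps)
    qed
    obtain s where s: "0 < s" "\<And>t. t \<in> T \<Longrightarrow> F t (x + s *\<^sub>R u) \<le> ereal (c + s * \<alpha>')"
    proof (rule sup_ray_bound[OF SH_cpt _ SH_usc _ \<epsilon>, where x = x and u = u and \<alpha> = \<alpha>' and c = c])
      fix t assume t: "t \<in> topspace TT" "F t x = ereal c"
      then have "t \<in> A" unfolding A_def T_def using c by simp
      then show "\<exists>s>0. F t (x + s *\<^sub>R u) < ereal (c - \<epsilon> + s * \<alpha>')"
        using eps_subdiff_support[of "F t" x c \<epsilon> u \<alpha> \<alpha>'] X t \<epsilon> \<alpha>'(1) act fprop[OF t(1)] by metis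
    next
      fix t assume t: "t \<in> topspace TT" "F t x \<noteq> ereal c"
      then have tA: "t \<in> T - A" unfolding A_def T_def using c by simp
      obtain d where d: "F t x = ereal d" using fin t(1) unfolding T_def by blast
      have "0 < \<epsilon> / \<rho> t" using \<epsilon> rho t(1) by simp
      then obtain s where "0 < s" "F t (x + s *\<^sub>R u) < ereal (d - \<epsilon> / \<rho> t + s * ((\<alpha> - a0 u) / (\<epsilon> * \<rho> t) + 1))"
        using eps_subdiff_support[of "F t" x d "\<epsilon> / \<rho> t" u "(\<alpha> - a0 u) / (\<epsilon> * \<rho> t)"
            "(\<alpha> - a0 u) / (\<epsilon> * \<rho> t) + 1"] X d inact[OF tA] fprop[OF t(1)] by auto
      then show "\<exists>s>0. F t (x + s *\<^sub>R u) < \<infinity>"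
        by (intro exI[of _ s]) auto
    qed (use fprop le in \<open>auto simp: T_def\<close>)
    \<comment> \<open>The subgradient inequality at this point of the ray forces
      \<open>\<phi> u \<le> \<alpha>'\<close>, against the choice of
      \<open>\<alpha>'\<close>.\<close>
    have "ereal (c + \<phi> (x + s *\<^sub>R u - x) - 0) \<le> f (x + s *\<^sub>R u)"
      by (rule eps_subdiffD(2)[OF \<phi> c])
    also have "\<dots> \<le> ereal (c + s * \<alpha>')"
      unfolding f_def using s(2) by (rule SUP_least)
    finally have "s * \<phi> u \<le> s * \<alpha>'"
      using eps_subdiffD(1)[OF \<phi>] by (simp add: dual_def linear_cmul)
    then show False using s(1) \<alpha>'(2) by simp
  qed

  \<comment> \<open>Common elements of the hulls are subgradients of the supremum\<close>
  moreover have "\<phi> \<in> eps_subdiff 0 f x" if \<phi>: "\<And>\<epsilon>. 0 < \<epsilon> \<Longrightarrow> \<phi> \<in> wcco (D \<epsilon>)" for \<phi>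
  proof -
    \<comment> \<open>The lower bound is taken nonpositive so that \<open>E\<close> below is
      nonnegative.\<close>
    obtain M where M: "M \<le> 0" "\<And>t. t \<in> T \<Longrightarrow> ereal M \<le> ereal (\<rho> t) * F t x"
    proof -
      obtain m where "ereal m < (INF t\<in>T. ereal (\<rho> t) * F t x)"
        using ereal_dense2[OF rhoinf] unfolding T_def by blast
      then have m: "ereal m \<le> ereal (\<rho> t) * F t x" if "t \<in> T" for t
        using INF_lower[OF that, of "\<lambda>t. ereal (\<rho> t) * F t x"] by (meson less_imp_le order_trans)
      show thesis
      proof (rule that[of "min m 0"])
        fix t assume "t \<in> T"
        then show "ereal (min m 0) \<le> ereal (\<rho> t) * F t x"
          by (intro order_trans[OF _ m]) auto
      qed simp
    qed
    have key: "ereal (c + \<phi> (y - x)) \<le> f y" for y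
    proof (cases "f y")
      case (real d)
      \<comment> \<open>Bounds \<open>\<rho> s * (F s y - F s x)\<close> for all \<open>s\<close>:
        the first term is at most \<open>max d 0\<close> because
        \<open>0 < \<rho> s \<le> 1\<close>, the second is at least \<open>M\<close>.\<close>
      define E where "E = max d 0 - M"
      have E: "0 \<le> E" using M(1) by (simp add: E_def)
      have est: "\<phi> (y - x) \<le> d - c + \<epsilon> + \<epsilon> * (E + \<epsilon>)" if \<epsilon>: "0 < \<epsilon>" for \<epsilon>
      proof (rule wcco_halfspace(2)[OF _ \<phi>[OF \<epsilon>]])
        fix \<psi> assume \<psi>: "\<psi> \<in> D \<epsilon>"
        then obtain t a b where t: "t \<in> A" "a \<in> eps_subdiff \<epsilon> (F t) x" and \<psi>_eq: "\<psi> = (\<lambda>z. a z + b z)"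
          and b: "b \<in> B \<epsilon>"
          unfolding memD by blast
        have "ereal (c + a (y - x) - \<epsilon>) \<le> F t y"
          using t c by (intro eps_subdiffD(2)) (auto simp: A_def)
        also have "\<dots> \<le> ereal d"
          using upper[of t y] t real by (simp add: A_def)
        finally have a: "a (y - x) \<le> d - c + \<epsilon>" by simp
        have "b (y - x) \<le> \<epsilon> * (E + \<epsilon>)"
        \<comment> \<open>The zero case absorbs the convention for \<open>A = T\<close> and the
          multiplier 0; otherwise the multiplier is \<open>\<epsilon>\<close>.\<close>
        proof (cases "b (y - x) = 0")
          case True
          then show ?thesis using E \<epsilon> by simp
        next
          case False
          then obtain s g where s: "s \<in> T" and g: "g \<in> eps_subdiff \<epsilon> (\<lambda>y. ereal (\<rho> s) * F s y) x"
            and bg: "b (y - x) = \<epsilon> * g (y - x)"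
            using b unfolding memB by (auto split: if_splits)
          have \<rho>: "0 < \<rho> s" "\<rho> s \<le> 1" using rho s unfolding T_def by auto
          obtain p where p: "F s x = ereal p" using fin[OF s] by blast
          obtain q where q: "F s y = ereal q" "q \<le> d"
            using upper[OF s, of y] notminf[OF s, of y] real by (cases "F s y") auto
          have "ereal (\<rho> s * p + g (y - x) - \<epsilon>) \<le> ereal (\<rho> s) * F s y"
            by (rule eps_subdiffD(2)[OF g]) (simp add: p)
          then have "\<rho> s * p + g (y - x) - \<epsilon> \<le> \<rho> s * q"
            by (simp add: q)
          moreover have "M \<le> \<rho> s * p"
            using M(2)[OF s] p by simp
          moreover have "\<rho> s * q \<le> max d 0"
          proof -
            have "\<rho> s * q \<le> \<rho> s * max d 0" using q(2) \<rho>(1) by simp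
            also have "\<dots> \<le> max d 0" using \<rho>(1,2) by (intro mult_left_le_one_le) auto
            finally show ?thesis .
          qed
          ultimately have "g (y - x) \<le> E + \<epsilon>" by (simp add: E_def)
          then show ?thesis using \<epsilon> bg by simp
        qed
        then show "\<psi> \<in> dual \<and> \<psi> (y - x) \<le> d - c + \<epsilon> + \<epsilon> * (E + \<epsilon>)"
          using a D_dual[OF \<psi>] by (simp add: \<psi>_eq)
      qed
      \<comment> \<open>\<open>E\<close> does not depend on \<open>\<epsilon>\<close>, so the error
        terms vanish as \<open>\<epsilon>\<close> tends to 0 from the right.\<close>
      have "((\<lambda>\<epsilon>. d - c + \<epsilon> + \<epsilon> * (E + \<epsilon>)) \<longlongrightarrow> d - c + 0 + 0 * (E + 0)) (at_right 0)"
        by (intro tendsto_intros)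
      moreover have "\<forall>\<^sub>F \<epsilon> in at_right 0. \<phi> (y - x) \<le> d - c + \<epsilon> + \<epsilon> * (E + \<epsilon>)"
        using est by (auto simp: eventually_at_filter)
      ultimately have "\<phi> (y - x) \<le> d - c + 0 + 0 * (E + 0)"
        by (rule tendsto_lowerbound) simp
      then show ?thesis using real by simp
    qed (use fnotminf in auto)
    \<comment> \<open>The half-space at \<open>z = 0\<close> with \<open>k = 0\<close> is the whole
      dual, since linear functionals vanish at 0.\<close>
    have "\<phi> \<in> dual"
      using wcco_halfspace(1)[OF _ \<phi>[of 1], of 0 0] D_dual by (auto simp: dual_def linear_0)
    then show ?thesis
      using key c by (simp add: eps_subdiff_def)
  qed
  ultimately have "eps_subdiff 0 f x = (\<Inter>\<epsilon>\<in>{0<..}. wcco (D \<epsilon>))"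
    by auto
  then show ?thesis
    unfolding D_def B_def A_def f_def T_def .
qed

end
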